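(* Let $A$ be a unital $\mathrm{C}^*$-algebra. Then $\mathcal{U}(A)_u$ is locally connected. Consequently, $\mathcal{U}(A)_u$ is bounded if and only if $\mathcal{U}(A)_u$ has finitely many connected components and $\mathcal{U}_0(A)_u$ is bounded.
   Context: $\mathcal{U}(A)_u$ is the unitary group of $A$ equipped with the norm topology; $\mathcal{U}_0(A)_u$ is its identity component, also with the norm topology. A topological group $G$ is bounded if for every open neighborhood $V$ of the identity in $G$ there exist $n\in\mathbb{N}$ and a finite set $F\subset G$ such that $G=V^nF$. *)

theory Defs
  imports "HOL-Analysis.Analysis" "HOL-Algebra.Coset"
begin

section \<open>Unital C*-algebras\<close>

text \<open>
  The library has only real normed algebras, so the complex scalar multiplication is a class
  parameter; the built-in real one is required to be its restriction to the reals.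
  The axiom \<open>norm 1 = 1\<close> of \<^class>\<open>real_normed_algebra_1\<close> is not imposed: it follows from the
  C*-identity unless \<open>1 = 0\<close>, and the zero algebra is thereby allowed.
\<close>

class unital_cstar_algebra = real_normed_algebra + monoid_mult + banach +
  fixes scaleC :: "complex \<Rightarrow> 'a \<Rightarrow> 'a" (infixr \<open>*\<^sub>C\<close> 75)
    and star :: "'a \<Rightarrow> 'a"
  assumes scaleR_scaleC: "r *\<^sub>R x = complex_of_real r *\<^sub>C x"
    and scaleC_add_right: "c *\<^sub>C (x + y) = c *\<^sub>C x + c *\<^sub>C y"
    and scaleC_add_left: "(c + d) *\<^sub>C x = c *\<^sub>C x + d *\<^sub>C x"
    and scaleC_scaleC: "c *\<^sub>C d *\<^sub>C x = (c * d) *\<^sub>C x"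
    and mult_scaleC_left: "(c *\<^sub>C x) * y = c *\<^sub>C (x * y)"
    and mult_scaleC_right: "x * (c *\<^sub>C y) = c *\<^sub>C (x * y)"
    and norm_scaleC: "norm (c *\<^sub>C x) = cmod c * norm x"
    and star_star: "star (star x) = x"
    and star_add: "star (x + y) = star x + star y"
    and star_scaleC: "star (c *\<^sub>C x) = cnj c *\<^sub>C star x"
    and star_mult: "star (x * y) = star y * star x"
    and cstar_identity: "norm (star x * x) = (norm x)\<^sup>2"

lemma norm_star:
  fixes x :: "'a::unital_cstar_algebra"
  shows "norm (star x) = norm x"
proof -
  have le: "norm y \<le> norm (star y)" for y :: 'a
  proof (cases "norm y = 0")
    case False
    have "norm y * norm y \<le> norm (star y) * norm y"
      using norm_mult_ineq[of "star y" y] by (simp add: cstar_identity power2_eq_square)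
    then show ?thesis
      using False by simp
  qed simp
  show ?thesis
    using le[of x] le[of "star x"] by (simp add: star_star)
qed

lemma star_one: "star (1 :: 'a::unital_cstar_algebra) = 1"
  by (metis mult_1_left mult_1_right star_mult star_star)

lemma star_diff:
  fixes x y :: "'a::unital_cstar_algebra"
  shows "star (x - y) = star x - star y"
  by (metis add_diff_cancel diff_add_cancel star_add)

lemma continuous_on_star: "continuous_on S (star :: 'a \<Rightarrow> 'a::unital_cstar_algebra)"
  by (rule continuous_on_iff[THEN iffD2]) (metis dist_norm norm_star star_diff)

section \<open>Topological groups\<close>

text \<open>No separation axiom is imposed.\<close>

locale topological_group = group G for G (structure) +
  fixes T :: "'a topology"
  assumes topspace_eq: "topspace T = carrier G"
    and continuous_map_mult: "continuous_map (prod_topology T T) T (\<lambda>(x, y). x \<otimes> y)"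
    and continuous_map_inv: "continuous_map T T (\<lambda>x. inv x)"
begin

text \<open>The iterate below is the setwise power \<open>V\<^sup>n\<close>, with \<open>V\<^sup>0 = {\<one>}\<close>.\<close>

definition bounded_group :: bool where
  "bounded_group \<longleftrightarrow>
    (\<forall>V. openin T V \<and> \<one> \<in> V \<longrightarrow>
      (\<exists>n F. finite F \<and> F \<subseteq> carrier G \<and> carrier G = ((\<lambda>W. V <#> W) ^^ n) {\<one>} <#> F))"

abbreviation identity_component :: "'a set" where
  "identity_component \<equiv> connected_component_of_set T \<one>"

lemma subgroup_identity_component: "subgroup identity_component G"
proof
  show "identity_component \<subseteq> carrier G"
    using connected_component_of_subset_topspace topspace_eq by metis
  show "\<one> \<in> identity_component"
    by (simp add: connected_component_of_refl topspace_eq)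
next
  fix x y
  assume "x \<in> identity_component" and "y \<in> identity_component"
  then have "connected_component_of (prod_topology T T) (\<one>, \<one>) (x, y)"
    using connected_component_of_pair[of T T \<one> \<one>] by auto
  from connected_component_of_continuous_image[OF continuous_map_mult this]
  show "x \<otimes> y \<in> identity_component"
    by simp
next
  fix x
  assume "x \<in> identity_component"
  then have "connected_component_of T \<one> x"
    by simp
  from connected_component_of_continuous_image[OF continuous_map_inv this]
  show "inv x \<in> identity_component"
    by simp
qed

lemma topological_group_subgroup:
  assumes "subgroup H G"
  shows "topological_group (G\<lparr>carrier := H\<rparr>) (subtopology T H)"
proof -
  interpret H: group "G\<lparr>carrier := H\<rparr>"
    using assms subgroup_imp_group by blast
  have sub: "H \<subseteq> carrier G"
    using assms by (rule subgroup.subset)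
  have inv_eq: "inv\<^bsub>G\<lparr>carrier := H\<rparr>\<^esub> x = inv x" if "x \<in> H" for x
    using m_inv_consistent[OF assms that] .
  show ?thesis
  proof
    show "topspace (subtopology T H) = carrier (G\<lparr>carrier := H\<rparr>)"
      using sub by (auto simp: topspace_eq)
    have "continuous_map (prod_topology (subtopology T H) (subtopology T H)) T (\<lambda>(x, y). x \<otimes> y)"
      using continuous_map_from_subtopology[OF continuous_map_mult]
      by (simp flip: subtopology_Times)
    then show "continuous_map (prod_topology (subtopology T H) (subtopology T H)) (subtopology T H)
        (\<lambda>(x, y). x \<otimes>\<^bsub>G\<lparr>carrier := H\<rparr>\<^esub> y)"
      using subgroup.m_closed[OF assms]
      by (auto simp: continuous_map_in_subtopology)
    have "continuous_map (subtopology T H) (subtopology T H) (\<lambda>x. inv x)"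
      using continuous_map_from_subtopology[OF continuous_map_inv] subgroup.m_inv_closed[OF assms]
      by (auto simp: continuous_map_in_subtopology)
    then show "continuous_map (subtopology T H) (subtopology T H) (\<lambda>x. inv\<^bsub>G\<lparr>carrier := H\<rparr>\<^esub> x)"
      by (rule continuous_map_eq) (auto simp: inv_eq)
  qed
qed

end

section \<open>The unitary group with the norm topology\<close>

definition unitary_elements :: "'a::unital_cstar_algebra set" where
  "unitary_elements = {u. star u * u = 1 \<and> u * star u = 1}"

definition unitary_group :: "'a::unital_cstar_algebra monoid" where
  "unitary_group = \<lparr>carrier = unitary_elements, mult = (*), one = 1\<rparr>"

definition unitary_topology :: "'a::unital_cstar_algebra topology" where
  "unitary_topology = top_of_set unitary_elements"

abbreviation unitary_identity_component :: "'a::unital_cstar_algebra set" where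
  "unitary_identity_component \<equiv> connected_component_of_set unitary_topology 1"

definition unitary_group_0 :: "'a::unital_cstar_algebra monoid" where
  "unitary_group_0 = unitary_group\<lparr>carrier := unitary_identity_component\<rparr>"

definition unitary_topology_0 :: "'a::unital_cstar_algebra topology" where
  "unitary_topology_0 = top_of_set unitary_identity_component"

lemma unitary_mult_closed:
  fixes u v :: "'a::unital_cstar_algebra"
  assumes "u \<in> unitary_elements" "v \<in> unitary_elements"
  shows "u * v \<in> unitary_elements"
proof -
  have "star v * star u * (u * v) = star v * (star u * u) * v"
    and "u * v * (star v * star u) = u * (v * star v) * star u"
    by (simp_all add: mult.assoc)
  then show ?thesis
    using assms by (simp add: unitary_elements_def star_mult)
qed

interpretation unitary: topological_group
  "unitary_group :: 'a::unital_cstar_algebra monoid" unitary_topology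
proof -
  let ?G = "unitary_group :: 'a monoid"
  let ?U = "unitary_elements :: 'a set"
  have grp: "group ?G"
  proof (rule groupI)
    fix x
    assume "x \<in> carrier ?G"
    then show "\<exists>y\<in>carrier ?G. y \<otimes>\<^bsub>?G\<^esub> x = \<one>\<^bsub>?G\<^esub>"
      by (intro bexI[of _ "star x"]) (simp_all add: unitary_group_def unitary_elements_def star_star)
  qed (auto simp: unitary_group_def unitary_mult_closed mult.assoc,
       simp add: unitary_elements_def star_one)
  then interpret group ?G .
  have inv_eq: "inv\<^bsub>?G\<^esub> x = star x" if "x \<in> ?U" for x
    using that by (intro inv_equality) (auto simp: unitary_group_def unitary_elements_def star_star)
  show "topological_group ?G unitary_topology"
  proof
    show "topspace unitary_topology = carrier ?G"
      by (simp add: unitary_topology_def unitary_group_def)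
    have "continuous_on (?U \<times> ?U) (\<lambda>(x, y). x * y)"
      by (auto simp: case_prod_unfold intro!: continuous_intros)
    then show "continuous_map (prod_topology unitary_topology unitary_topology) unitary_topology
        (\<lambda>(x, y). x \<otimes>\<^bsub>?G\<^esub> y)"
      using unitary_mult_closed
      by (auto simp: unitary_topology_def unitary_group_def subtopology_Times[symmetric]
          continuous_map_in_subtopology euclidean_product_topology)
    have "continuous_map unitary_topology unitary_topology (star :: 'a \<Rightarrow> 'a)"
      by (auto simp: unitary_topology_def continuous_map_in_subtopology continuous_on_star)
         (simp add: unitary_elements_def star_star)
    then show "continuous_map unitary_topology unitary_topology (\<lambda>x. inv\<^bsub>?G\<^esub> x)"
      by (rule continuous_map_eq) (auto simp: unitary_topology_def inv_eq)
  qed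
qed

interpretation unitary_0: topological_group
  "unitary_group_0 :: 'a::unital_cstar_algebra monoid" unitary_topology_0
proof -
  have one: "\<one>\<^bsub>unitary_group\<^esub> = (1 :: 'a)"
    by (simp add: unitary_group_def)
  have "(unitary_identity_component :: 'a set) \<subseteq> unitary_elements"
    using connected_component_of_subset_topspace[of unitary_topology "1 :: 'a"]
    by (simp add: unitary_topology_def)
  then have "unitary_topology_0 = subtopology unitary_topology (unitary_identity_component :: 'a set)"
    by (simp add: unitary_topology_0_def unitary_topology_def subtopology_subtopology inf.absorb2)
  then show "topological_group (unitary_group_0 :: 'a monoid) unitary_topology_0"
    using unitary.topological_group_subgroup[OF unitary.subgroup_identity_component, where ?'a = 'a]
    by (simp add: unitary_group_0_def one)
qed

end

theory Submission
  imports Defs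
begin

text \<open>
  Local connectedness rests on a form of the Cayley transform. Near \<open>1\<close> every unitary \<open>u\<close> is
  \<open>2w - 1\<close> for the invertible element \<open>w = (1 + u) / 2\<close>, and \<open>2w - 1\<close> is unitary exactly
  when \<open>v = w\<^sup>-\<^sup>1\<close> satisfies \<open>v + v\<^sup>* = 2\<close>
  (lemma \<open>unitary_iff_inverse_real_part_one\<close>): inversion turns the curved
  condition of unitarity into an affine one, just as \<open>z \<mapsto> 1/z\<close> maps the circle with diameter
  \<open>[0, 1]\<close> to the line \<open>Re z = 1\<close>. Small balls of that affine space are convex, and inversion
  is Lipschitz near \<open>1\<close>; so \<open>1\<close> has arbitrarily small connected neighbourhoods in the unitary
  group (lemma \<open>weakly_locally_connected_at_one_unitary\<close>), and translation carries them to every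
  other point.

  The statement on boundedness holds for every topological group whose identity component is
  open. The connected components are the cosets of the identity component, so it is enough to
  compare a group \<open>G\<close> with an open subgroup \<open>H\<close> (lemma \<open>bounded_group_iff_open_subgroup\<close>).
  If \<open>G\<close> is bounded, then \<open>H\<close> itself is a neighbourhood of the identity with powers inside \<open>H\<close>, so
  finitely many cosets of \<open>H\<close> cover \<open>G\<close>; and of a covering \<open>G = V\<^sup>n F\<close> with \<open>V \<subseteq> H\<close> only the
  translates by \<open>F \<inter> H\<close> meet \<open>H\<close>. Conversely, a covering of \<open>H\<close> is spread over \<open>G\<close> by finitely many
  coset representatives.
\<close>

section \<open>Local connectedness and bounded subgroups of topological groups\<close>

context topological_group
begin

lemma continuous_map_right_translation:
  assumes "x \<in> carrier G"
  shows "continuous_map T T (\<lambda>y. y \<otimes> x)"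
proof -
  have "continuous_map T (prod_topology T T) (\<lambda>y. (y, x))"
    using assms by (simp add: continuous_map_pairedI topspace_eq)
  from continuous_map_compose[OF this continuous_map_mult] show ?thesis
    by (simp add: o_def)
qed

text \<open>Right translations are homeomorphisms that act transitively.\<close>
lemma locally_connected_space_if_at_one:
  assumes "weakly_locally_connected_at \<one> T"
  shows "locally_connected_space T"
  unfolding locally_connected_space_im_kleinen
proof (intro allI impI)
  fix V x
  assume "openin T V \<and> x \<in> V"
  then have V: "openin T V" "x \<in> V" and x: "x \<in> carrier G"
    using openin_subset topspace_eq by blast+
  define V' where "V' = {y \<in> topspace T. y \<otimes> x \<in> V}"
  have "openin T V'"
    unfolding V'_def
    using openin_continuous_map_preimage[OF continuous_map_right_translation[OF x] V(1)] .
  moreover have "\<one> \<in> V'"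
    using V x by (simp add: V'_def topspace_eq)
  ultimately obtain U' where U': "openin T U'" "\<one> \<in> U'" "U' \<subseteq> V'"
    and conn: "\<forall>y\<in>U'. \<exists>C. connectedin T C \<and> C \<subseteq> V' \<and> \<one> \<in> C \<and> y \<in> C"
    using assms unfolding weakly_locally_connected_at by meson
  define U where "U = {y \<in> topspace T. y \<otimes> inv x \<in> U'}"
  have cancel: "y \<otimes> inv x \<otimes> x = y" if "y \<in> topspace T" for y
    using that x by (simp add: m_assoc topspace_eq)
  have "openin T U"
    unfolding U_def
    using openin_continuous_map_preimage[OF continuous_map_right_translation U'(1)] x by simp
  moreover have "x \<in> U"
    using U' x by (simp add: U_def topspace_eq)
  moreover have "U \<subseteq> V"
    using U'(3) cancel by (force simp: U_def V'_def)
  moreover have "\<exists>C. connectedin T C \<and> C \<subseteq> V \<and> x \<in> C \<and> y \<in> C" if y: "y \<in> U" for y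
  proof -
    obtain C where C: "connectedin T C" "C \<subseteq> V'" "\<one> \<in> C" "y \<otimes> inv x \<in> C"
      using conn y unfolding U_def by blast
    have "connectedin T ((\<lambda>z. z \<otimes> x) ` C)"
      using connectedin_continuous_map_image[OF continuous_map_right_translation[OF x] C(1)] .
    moreover have "(\<lambda>z. z \<otimes> x) ` C \<subseteq> V"
      using C(2) by (auto simp: V'_def)
    moreover have "x \<in> (\<lambda>z. z \<otimes> x) ` C"
      using C(3) x by (intro image_eqI[where x = \<one>]) auto
    moreover have "y \<in> (\<lambda>z. z \<otimes> x) ` C"
      using C(4) y cancel by (intro image_eqI[where x = "y \<otimes> inv x"]) (auto simp: U_def)
    ultimately show ?thesis
      by blast
  qed
  ultimately show "\<exists>U. openin T U \<and> x \<in> U \<and> U \<subseteq> V \<and>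
      (\<forall>y\<in>U. \<exists>C. connectedin T C \<and> C \<subseteq> V \<and> x \<in> C \<and> y \<in> C)"
    by blast
qed

lemma connected_component_eq_rcoset:
  assumes x: "x \<in> carrier G"
  shows "connected_component_of_set T x = identity_component #> x"
proof (rule Set.set_eqI)
  fix y
  interpret H: subgroup identity_component G
    by (rule subgroup_identity_component)
  have "connected_component_of T x y \<longleftrightarrow> connected_component_of T \<one> (y \<otimes> inv x)"
    if "y \<in> carrier G"
  proof
    assume "connected_component_of T x y"
    from connected_component_of_continuous_image[OF continuous_map_right_translation this, of "inv x"]
    show "connected_component_of T \<one> (y \<otimes> inv x)"
      using x by simp
  next
    assume "connected_component_of T \<one> (y \<otimes> inv x)"
    from connected_component_of_continuous_image[OF continuous_map_right_translation[OF x] this]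
    show "connected_component_of T x y"
      using x that by (simp add: m_assoc)
  qed
  moreover have "y \<in> carrier G" if "y \<in> connected_component_of_set T x"
    using that connected_component_of_subset_topspace[of T x] topspace_eq by (metis subsetD)
  moreover have "y \<in> carrier G" if "y \<in> identity_component #> x"
    using that x H.elemrcos_carrier is_group by blast
  ultimately show "y \<in> connected_component_of_set T x \<longleftrightarrow> y \<in> identity_component #> x"
    using H.rcos_module[OF is_group x] by (metis mem_Collect_eq)
qed

lemma connected_components_eq_rcosets:
  "connected_components_of T = rcosets identity_component"
proof -
  have "connected_components_of T = (\<lambda>x. identity_component #> x) ` carrier G"
    unfolding connected_components_of_def topspace_eq
    by (rule image_cong) (simp_all only: connected_component_eq_rcoset)
  then show ?thesis
    by (auto simp: RCOSETS_def)
qed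

lemma set_power_mono:
  assumes "V \<subseteq> W"
  shows "((\<lambda>X. V <#> X) ^^ n) S \<subseteq> ((\<lambda>X. W <#> X) ^^ n) S"
proof (induction n)
  case (Suc n)
  then show ?case
    using mono_set_mult[OF assms Suc.IH] by simp
qed simp

lemma set_power_subset_subgroup:
  assumes H: "subgroup H G" and "V \<subseteq> H"
  shows "((\<lambda>X. V <#> X) ^^ n) {\<one>} \<subseteq> H"
proof (induction n)
  case 0
  show ?case
    using subgroup.one_closed[OF H] by simp
next
  case (Suc n)
  then have "V <#> ((\<lambda>X. V <#> X) ^^ n) {\<one>} \<subseteq> H <#> H"
    using \<open>V \<subseteq> H\<close> by (intro mono_set_mult)
  then show ?case
    using subgroup_mult_id[OF H] by simp
qed

text \<open>
  Boundedness applied to the neighbourhood \<open>H\<close> forces finite index, since \<open>H\<^sup>n \<subseteq> H\<close>. Apart from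
  that, neighbourhoods of the identity may be shrunk into \<open>H\<close>, where they are open in both groups,
  and their powers then do not leave \<open>H\<close>.
\<close>
lemma bounded_group_iff_open_subgroup:
  assumes H: "subgroup H G" and opn: "openin T H"
  shows "bounded_group \<longleftrightarrow>
    finite (rcosets H) \<and> topological_group.bounded_group (G\<lparr>carrier := H\<rparr>) (subtopology T H)"
proof -
  interpret H: subgroup H G
    by (rule H)
  interpret TH: topological_group "G\<lparr>carrier := H\<rparr>" "subtopology T H"
    using topological_group_subgroup[OF H] .
  have "set_mult (G\<lparr>carrier := H\<rparr>) = set_mult G"
    by (intro ext) (simp add: set_mult_def)
  then have boundedH: "TH.bounded_group \<longleftrightarrow> (\<forall>V. openin T V \<and> V \<subseteq> H \<and> \<one> \<in> V \<longrightarrow>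
      (\<exists>n F. finite F \<and> F \<subseteq> H \<and> H = ((\<lambda>W. V <#> W) ^^ n) {\<one>} <#> F))"
    unfolding TH.bounded_group_def by (simp add: openin_open_subtopology[OF opn])
  show ?thesis
  proof
    assume G: bounded_group
    have "finite (rcosets H)"
    proof -
      obtain n F where F: "finite F" "F \<subseteq> carrier G"
        "carrier G = ((\<lambda>W. H <#> W) ^^ n) {\<one>} <#> F"
        using G[unfolded bounded_group_def, rule_format, OF conjI[OF opn H.one_closed]] by metis
      have "rcosets H \<subseteq> (\<lambda>f. H #> f) ` F"
      proof
        fix R
        assume "R \<in> rcosets H"
        then obtain x where x: "x \<in> carrier G" and R: "R = H #> x"
          by (auto simp: RCOSETS_def)
        have "x \<in> H <#> F"
          using x F(3) mono_set_mult[OF set_power_subset_subgroup[OF H order.refl] order.refl]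
          by blast
        then obtain f where "f \<in> F" "x \<in> H #> f"
          by (auto simp: set_mult_def r_coset_def)
        then show "R \<in> (\<lambda>f. H #> f) ` F"
          using R F(2) repr_independence[OF _ _ H] by blast
      qed
      then show ?thesis
        using F(1) finite_surj by blast
    qed
    moreover have "TH.bounded_group"
      unfolding boundedH
    proof (intro allI impI)
      fix V
      assume V: "openin T V \<and> V \<subseteq> H \<and> \<one> \<in> V"
      then obtain n F where F: "finite F" "F \<subseteq> carrier G"
        "carrier G = ((\<lambda>W. V <#> W) ^^ n) {\<one>} <#> F"
        using G[unfolded bounded_group_def, rule_format, of V] by metis
      let ?P = "((\<lambda>W. V <#> W) ^^ n) {\<one>}"
      have P: "?P \<subseteq> H"
        using set_power_subset_subgroup[OF H] V by blast
      have "?P <#> (F \<inter> H) \<subseteq> H"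
        using mono_set_mult[OF P, of "F \<inter> H" H] subgroup_mult_id[OF H] by auto
      moreover have "H \<subseteq> ?P <#> (F \<inter> H)"
      proof
        fix h
        assume h: "h \<in> H"
        then obtain p f where pf: "p \<in> ?P" "f \<in> F" "h = p \<otimes> f"
          using F(3) H.subset h unfolding set_mult_def by auto
        have p: "p \<in> H" and fG: "f \<in> carrier G"
          using pf P F(2) by auto
        have "f = inv p \<otimes> h"
          using pf(3) p fG by (simp add: inv_solve_left)
        then have "f \<in> H"
          using h p by simp
        then show "h \<in> ?P <#> (F \<inter> H)"
          using pf by (auto simp: set_mult_def)
      qed
      ultimately show "\<exists>n F. finite F \<and> F \<subseteq> H \<and> H = ((\<lambda>W. V <#> W) ^^ n) {\<one>} <#> F"
        using F(1) by (intro exI[of _ n] exI[of _ "F \<inter> H"]) auto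
    qed
    ultimately show "finite (rcosets H) \<and> TH.bounded_group"
      by blast
  next
    assume fin_bd: "finite (rcosets H) \<and> TH.bounded_group"
    have "rcosets H = (\<lambda>x. H #> x) ` carrier G"
      by (auto simp: RCOSETS_def)
    then obtain R where R: "R \<subseteq> carrier G" "finite R" "rcosets H = (\<lambda>x. H #> x) ` R"
      using fin_bd finite_subset_image[of "rcosets H" "\<lambda>x. H #> x" "carrier G"] by auto
    show bounded_group
      unfolding bounded_group_def
    proof (intro allI impI)
      fix V
      assume V: "openin T V \<and> \<one> \<in> V"
      then have "openin T (V \<inter> H) \<and> V \<inter> H \<subseteq> H \<and> \<one> \<in> V \<inter> H"
        using opn by auto
      then obtain n F where F: "finite F" "F \<subseteq> H" "H = ((\<lambda>W. (V \<inter> H) <#> W) ^^ n) {\<one>} <#> F"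
        using fin_bd[THEN conjunct2, unfolded boundedH, rule_format, of "V \<inter> H"] by metis
      let ?P = "((\<lambda>W. V <#> W) ^^ n) {\<one>}"
      have V_sub: "V \<subseteq> carrier G"
        using V openin_subset topspace_eq by blast
      have P: "?P \<subseteq> carrier G"
        using set_power_subset_subgroup[OF subgroup_self V_sub] .
      have FR: "F <#> R \<subseteq> carrier G"
        using F(2) R(1) H.subset by (intro set_mult_closed) auto
      have "H \<subseteq> ?P <#> F"
        using F(3) mono_set_mult[OF set_power_mono[of "V \<inter> H" V] order.refl] by blast
      then have "H <#> R \<subseteq> ?P <#> F <#> R"
        by (intro mono_set_mult) auto
      also have "\<dots> = ?P <#> (F <#> R)"
        using P F(2) R(1) H.subset by (intro set_mult_assoc) auto
      finally have "H <#> R \<subseteq> ?P <#> (F <#> R)" .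
      moreover have "carrier G \<subseteq> H <#> R"
      proof
        fix x
        assume x: "x \<in> carrier G"
        then obtain r where "r \<in> R" "H #> x = H #> r"
          using R(3) rcosetsI[OF H.subset] by blast
        then show "x \<in> H <#> R"
          using rcos_self[OF x H] by (auto simp: set_mult_def r_coset_def)
      qed
      moreover have "?P <#> (F <#> R) \<subseteq> carrier G"
        using P FR by (rule set_mult_closed)
      moreover have "finite (F <#> R)"
        using F(1) R(2) by (simp add: set_mult_def)
      ultimately show "\<exists>n F. finite F \<and> F \<subseteq> carrier G \<and> carrier G = ((\<lambda>W. V <#> W) ^^ n) {\<one>} <#> F"
        using FR by (intro exI[of _ n] exI[of _ "F <#> R"]) auto
    qed
  qed
qed

end

section \<open>Inversion near the unit of a Banach algebra\<close>

text \<open>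
  A right inverse is a fixed point of the contraction \<open>y \<mapsto> 1 + (1 - w) y\<close>, a left inverse one of
  \<open>y \<mapsto> 1 + y (1 - w)\<close>. Banach's fixed point theorem takes the place of the Neumann series because
  the powers of \<open>1 - w\<close> start with \<open>1\<close>, whose norm may differ from one here.
\<close>
lemma invertible_near_one:
  fixes w :: "'a::{real_normed_algebra, monoid_mult, banach}"
  assumes "norm (1 - w) < 1"
  obtains v where "w * v = 1" "v * w = 1"
proof -
  have "\<exists>!y. 1 + (1 - w) * y = y"
  proof (rule banach_fix_type[where c = "norm (1 - w)"])
    have "dist (1 + (1 - w) * x) (1 + (1 - w) * y) \<le> norm (1 - w) * dist x y"
      for x y
      using norm_mult_ineq[of "1 - w" "x - y"] by (simp add: dist_norm right_diff_distrib)
    then show "\<forall>x y. dist (1 + (1 - w) * x) (1 + (1 - w) * y) \<le> norm (1 - w) * dist x y"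
      by blast
  qed (use assms in auto)
  then obtain y where "1 + (1 - w) * y = y"
    by blast
  then have right: "w * y = 1"
    by (simp add: left_diff_distrib)
  have "\<exists>!y. 1 + y * (1 - w) = y"
  proof (rule banach_fix_type[where c = "norm (1 - w)"])
    have "dist (1 + x * (1 - w)) (1 + y * (1 - w)) \<le> norm (1 - w) * dist x y"
      for x y
      using norm_mult_ineq[of "x - y" "1 - w"] by (simp add: dist_norm left_diff_distrib mult.commute[of "norm (1 - w)"])
    then show "\<forall>x y. dist (1 + x * (1 - w)) (1 + y * (1 - w)) \<le> norm (1 - w) * dist x y"
      by blast
  qed (use assms in auto)
  then obtain z where "1 + z * (1 - w) = z"
    by blast
  then have left: "z * w = 1"
    by (simp add: right_diff_distrib)
  have "z = y"
    using left right by (metis mult.assoc mult_1_left mult_1_right)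
  with left right that show thesis
    by blast
qed

definition algebra_inverse :: "'a::monoid_mult \<Rightarrow> 'a" where
  "algebra_inverse w = (THE v. w * v = 1 \<and> v * w = 1)"

lemma algebra_inverse_unique:
  assumes "w * v = 1" "v * w = 1"
  shows "algebra_inverse w = v"
  unfolding algebra_inverse_def
  using assms by (intro the_equality) (auto, metis mult.assoc mult_1_left mult_1_right)

lemma algebra_inverse_near_one:
  fixes w :: "'a::{real_normed_algebra, monoid_mult, banach}"
  assumes "w \<in> cball 1 (1 / 2)"
  shows "w * algebra_inverse w = 1" "algebra_inverse w * w = 1"
    "norm (algebra_inverse w) \<le> 2 * norm (1 :: 'a)"
proof -
  have half: "norm (1 - w) \<le> 1 / 2"
    using assms by (simp add: dist_norm)
  then obtain v where v: "w * v = 1" "v * w = 1"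
    using invertible_near_one[of w] by auto
  then have eq: "algebra_inverse w = v"
    by (rule algebra_inverse_unique)
  show "w * algebra_inverse w = 1" "algebra_inverse w * w = 1"
    using v eq by simp_all
  have "v = 1 + (1 - w) * v"
    using v by (simp add: left_diff_distrib)
  then have "norm v \<le> norm (1 :: 'a) + norm ((1 - w) * v)"
    by (metis norm_triangle_ineq)
  also have "norm ((1 - w) * v) \<le> 1 / 2 * norm v"
    using norm_mult_ineq[of "1 - w" v] mult_right_mono[OF half norm_ge_zero[of v]] by linarith
  finally show "norm (algebra_inverse w) \<le> 2 * norm (1 :: 'a)"
    using eq by simp
qed

lemma lipschitz_on_algebra_inverse:
  "((2 * norm (1 :: 'a))\<^sup>2)-lipschitz_on (cball 1 (1 / 2))
    (algebra_inverse :: 'a::{real_normed_algebra, monoid_mult, banach} \<Rightarrow> 'a)"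
proof (rule lipschitz_onI)
  fix w w' :: 'a
  assume w: "w \<in> cball 1 (1 / 2)" and w': "w' \<in> cball 1 (1 / 2)"
  let ?v = "algebra_inverse w" and ?v' = "algebra_inverse w'"
  have "?v - ?v' = ?v * (w' * ?v') - (?v * w) * ?v'"
    using algebra_inverse_near_one[OF w] algebra_inverse_near_one[OF w'] by simp
  also have "\<dots> = ?v * (w' - w) * ?v'"
    by (simp add: algebra_simps)
  finally have "norm (?v - ?v') \<le> norm ?v * norm (w' - w) * norm ?v'"
    by (metis (no_types, lifting) mult_right_mono norm_ge_zero norm_mult_ineq order_trans)
  also have "\<dots> \<le> (2 * norm (1 :: 'a)) * norm (w' - w) * (2 * norm (1 :: 'a))"
    using algebra_inverse_near_one(3)[OF w] algebra_inverse_near_one(3)[OF w']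
    by (intro mult_mono) auto
  finally show "dist ?v ?v' \<le> (2 * norm (1 :: 'a))\<^sup>2 * dist w w'"
    by (simp add: dist_norm norm_minus_commute power2_eq_square mult_ac)
qed simp

section \<open>Connected neighbourhoods of the identity in the unitary group\<close>

lemma star_scaleR:
  fixes x :: "'a::unital_cstar_algebra"
  shows "star (r *\<^sub>R x) = r *\<^sub>R star x"
  by (simp add: scaleR_scaleC star_scaleC)

text \<open>
  Unitarity of \<open>2w - 1\<close> means \<open>2 w\<^sup>* w = w + w\<^sup>* = 2 w w\<^sup>*\<close>. Multiplying \<open>v + v\<^sup>* = 2\<close> by \<open>w\<^sup>*\<close>
  on the left and \<open>w\<close> on the right gives the first equation, by \<open>w\<close> and \<open>w\<^sup>*\<close> the second; multiplying
  the first by \<open>v\<^sup>*\<close> and \<open>v\<close> goes back.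
\<close>
lemma unitary_iff_inverse_real_part_one:
  fixes v w :: "'a::unital_cstar_algebra"
  assumes wv: "w * v = 1" and vw: "v * w = 1"
  shows "2 *\<^sub>R w - 1 \<in> unitary_elements \<longleftrightarrow> v + star v = 2 *\<^sub>R 1"
proof -
  have star_wv: "star v * star w = 1" and star_vw: "star w * star v = 1"
    using wv vw by (metis star_mult star_one)+
  have star_eq: "star (2 *\<^sub>R w - 1) = 2 *\<^sub>R star w - 1"
    by (simp add: star_diff star_scaleR star_one)
  have affine_if: "2 *\<^sub>R (a * b) = a + b" if "(2 *\<^sub>R a - 1) * (2 *\<^sub>R b - 1) = 1" for a b :: 'a
  proof -
    have "(2 *\<^sub>R a - 1) * (2 *\<^sub>R b - 1) = 1 + 2 *\<^sub>R (2 *\<^sub>R (a * b) - (a + b))"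
      by (simp add: algebra_simps)
    then show ?thesis
      using that by simp
  qed
  have if_affine: "(2 *\<^sub>R a - 1) * (2 *\<^sub>R b - 1) = 1" if "2 *\<^sub>R (a * b) = a + b" for a b :: 'a
  proof -
    have "(2 *\<^sub>R a - 1) * (2 *\<^sub>R b - 1) = 1 + 2 *\<^sub>R (2 *\<^sub>R (a * b) - (a + b))"
      by (simp add: algebra_simps)
    then show ?thesis
      using that by simp
  qed
  show ?thesis
  proof
    assume "2 *\<^sub>R w - 1 \<in> unitary_elements"
    then have "2 *\<^sub>R (star w * w) = star w + w"
      unfolding unitary_elements_def using star_eq affine_if by simp
    then have "star v * (2 *\<^sub>R (star w * w)) * v = star v * (star w + w) * v"
      by simp
    moreover have "star v * (2 *\<^sub>R (star w * w)) * v = 2 *\<^sub>R ((star v * star w) * (w * v))"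
      by (simp add: mult.assoc)
    moreover have "star v * (star w + w) * v = (star v * star w) * v + star v * (w * v)"
      by (simp add: algebra_simps)
    ultimately show "v + star v = 2 *\<^sub>R 1"
      using wv star_wv by simp
  next
    assume v: "v + star v = 2 *\<^sub>R 1"
    have "star w * (v + star v) * w = star w * (v * w) + (star w * star v) * w"
      by (simp add: algebra_simps)
    then have "2 *\<^sub>R (star w * w) = star w + w"
      using v vw star_vw by simp
    moreover have "w * (v + star v) * star w = (w * v) * star w + w * (star v * star w)"
      by (simp add: algebra_simps)
    then have "2 *\<^sub>R (w * star w) = w + star w"
      using v wv star_wv by (simp add: add.commute)
    ultimately show "2 *\<^sub>R w - 1 \<in> unitary_elements"
      unfolding unitary_elements_def using star_eq if_affine by simp
  qed
qed

text \<open>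
  The connected neighbourhood of \<open>1\<close> is the image of a small ball of the affine space
  \<open>v + v\<^sup>* = 2\<close> under \<open>v \<mapsto> 2 v\<^sup>-\<^sup>1 - 1\<close>. It is small because inversion is Lipschitz near \<open>1\<close>, and it is a
  neighbourhood because inversion is its own inverse: a unitary \<open>u\<close> near \<open>1\<close> comes from the point \<open>w\<^sup>-\<^sup>1\<close>
  with \<open>w = (1 + u) / 2\<close>, again near \<open>1\<close>.
\<close>
lemma weakly_locally_connected_at_one_unitary:
  "weakly_locally_connected_at 1 (unitary_topology :: 'a::unital_cstar_algebra topology)"
  unfolding weakly_locally_connected_at
proof (intro allI impI)
  fix V :: "'a set"
  assume V: "openin unitary_topology V \<and> 1 \<in> V"
  then obtain e where e: "e > 0" "ball 1 e \<inter> unitary_elements \<subseteq> V" and V_sub: "V \<subseteq> unitary_elements"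
    unfolding unitary_topology_def openin_contains_ball by blast
  \<comment> \<open>Adding \<open>1\<close> keeps the Lipschitz constant positive when the algebra is zero.\<close>
  define L where "L = (2 * norm (1 :: 'a))\<^sup>2 + 1"
  have L: "L > 0"
    by (simp add: L_def add_nonneg_pos)
  have lip: "L-lipschitz_on (cball 1 (1 / 2)) (algebra_inverse :: 'a \<Rightarrow> 'a)"
    using lipschitz_on_algebra_inverse by (rule lipschitz_on_le) (simp add: L_def)
  have inv_one: "algebra_inverse 1 = (1 :: 'a)"
    by (rule algebra_inverse_unique) simp_all
  have lip_one: "dist 1 (algebra_inverse w) \<le> L * dist 1 w" if "w \<in> cball 1 (1 / 2)" for w :: 'a
    using lipschitz_onD[OF lip _ that, of 1] inv_one by simp
  \<comment> \<open>\<open>v \<mapsto> 2 v\<^sup>-\<^sup>1 - 1\<close> has Lipschitz constant \<open>2 L\<close>, so the ball of radius \<open>r\<close> lands within \<open>e / 2\<close> of \<open>1\<close>.\<close>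
  define r where "r = min (1 / 2) (e / (4 * L))"
  have r: "r > 0" "r \<le> 1 / 2" "r \<le> e / (4 * L)"
    using e L by (simp_all add: r_def)
  define S where "S = {v :: 'a. v + star v = 2 *\<^sub>R 1} \<inter> cball 1 r"
  define \<phi> where "\<phi> v = 2 *\<^sub>R algebra_inverse v - (1 :: 'a)" for v
  have S_half: "S \<subseteq> cball 1 (1 / 2)"
    using r(2) by (auto simp: S_def)
  have "convex {v :: 'a. v + star v = 2 *\<^sub>R 1}"
  proof (rule convexI)
    fix x y :: 'a and a b :: real
    assume "x \<in> {v. v + star v = 2 *\<^sub>R 1}" "y \<in> {v. v + star v = 2 *\<^sub>R 1}" "a + b = 1"
    moreover have "a *\<^sub>R x + b *\<^sub>R y + star (a *\<^sub>R x + b *\<^sub>R y) = a *\<^sub>R (x + star x) + b *\<^sub>R (y + star y)"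
      by (simp add: star_add star_scaleR algebra_simps)
    ultimately show "a *\<^sub>R x + b *\<^sub>R y \<in> {v. v + star v = 2 *\<^sub>R 1}"
      by (simp flip: scaleR_left_distrib distrib_right)
  qed
  then have "convex S"
    unfolding S_def by (intro convex_Int convex_cball)
  moreover have "continuous_on S \<phi>"
    unfolding \<phi>_def
    using lipschitz_on_continuous_on[OF lip] S_half
    by (intro continuous_intros) (rule continuous_on_subset)
  ultimately have conn: "connected (\<phi> ` S)"
    by (intro connected_continuous_image convex_connected)
  have unit: "\<phi> v \<in> unitary_elements" if "v \<in> S" for v
  proof -
    have "v \<in> cball 1 (1 / 2)" and "v + star v = 2 *\<^sub>R 1"
      using that S_half by (auto simp: S_def)
    then show ?thesis
      unfolding \<phi>_def
      using unitary_iff_inverse_real_part_one[of "algebra_inverse v" v] algebra_inverse_near_one[of v]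
      by simp
  qed
  have "\<phi> v \<in> ball 1 e" if "v \<in> S" for v
  proof -
    have "1 - \<phi> v = 2 *\<^sub>R (1 - algebra_inverse v)"
      unfolding \<phi>_def by (simp add: scaleR_right_diff_distrib scaleR_2)
    then have "dist 1 (\<phi> v) = 2 * dist 1 (algebra_inverse v)"
      by (simp add: dist_norm)
    also have "\<dots> \<le> 2 * (L * dist 1 v)"
      using lip_one that S_half by auto
    also have "\<dots> \<le> 2 * (L * (e / (4 * L)))"
      using that r L by (intro mult_left_mono) (auto simp: S_def)
    also have "\<dots> < e"
      using e L by simp
    finally show ?thesis
      by simp
  qed
  then have image_sub: "\<phi> ` S \<subseteq> V"
    using unit e(2) by blast
  \<comment> \<open>For \<open>u\<close> in the ball of radius \<open>\<delta>\<close>, \<open>w = (1 + u) / 2\<close> is so close to \<open>1\<close> that it is invertible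
    and its inverse lies within \<open>r\<close> of \<open>1\<close>.\<close>
  define \<delta> where "\<delta> = 2 * min (1 / 2) (r / L)"
  have \<delta>: "\<delta> > 0" "\<delta> \<le> 1" "L * (\<delta> / 2) \<le> r"
  proof -
    show "\<delta> > 0" "\<delta> \<le> 1"
      using r L by (simp_all add: \<delta>_def)
    have "\<delta> / 2 \<le> r / L"
      by (simp add: \<delta>_def)
    then show "L * (\<delta> / 2) \<le> r"
      using L by (simp add: field_simps)
  qed
  have image_nbhd: "u \<in> \<phi> ` S" if u: "u \<in> unitary_elements" "u \<in> ball 1 \<delta>" for u
  proof -
    define w where "w = (1 / 2) *\<^sub>R (1 + u)"
    have u_eq: "u = 2 *\<^sub>R w - 1"
      by (simp add: w_def)
    have "1 - w = (1 / 2) *\<^sub>R (1 - u)"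
      by (simp add: w_def algebra_simps flip: scaleR_left_distrib)
    then have "dist 1 w = dist 1 u / 2"
      by (simp add: dist_norm)
    then have dist_w: "dist 1 w \<le> \<delta> / 2"
      using u(2) by simp
    then have w: "w \<in> cball 1 (1 / 2)"
      using \<delta>(2) by simp
    note inv = algebra_inverse_near_one[OF w]
    have "algebra_inverse w + star (algebra_inverse w) = 2 *\<^sub>R 1"
      using unitary_iff_inverse_real_part_one[OF inv(1,2)] u(1) u_eq by simp
    moreover have "L * dist 1 w \<le> L * (\<delta> / 2)"
      using dist_w L by (intro mult_left_mono) auto
    then have "dist 1 (algebra_inverse w) \<le> r"
      using lip_one[OF w] \<delta>(3) by linarith
    ultimately have "algebra_inverse w \<in> S"
      by (simp add: S_def)
    moreover have "algebra_inverse (algebra_inverse w) = w"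
      using inv by (intro algebra_inverse_unique)
    ultimately show ?thesis
      unfolding \<phi>_def u_eq by (intro image_eqI[where x = "algebra_inverse w"]) auto
  qed
  have one: "(1 :: 'a) \<in> unitary_elements"
    by (simp add: unitary_elements_def star_one)
  have "connectedin unitary_topology (\<phi> ` S)"
    using conn unit by (auto simp: unitary_topology_def connectedin_subtopology)
  moreover have "openin unitary_topology (unitary_elements \<inter> ball (1 :: 'a) \<delta>)"
    by (simp add: unitary_topology_def openin_open_Int)
  ultimately show "\<exists>U. openin unitary_topology U \<and> 1 \<in> U \<and> U \<subseteq> V \<and>
      (\<forall>y\<in>U. \<exists>C. connectedin unitary_topology C \<and> C \<subseteq> V \<and> 1 \<in> C \<and> y \<in> C)"
    using image_sub image_nbhd one \<delta>(1)
    by (intro exI[of _ "unitary_elements \<inter> ball 1 \<delta>"] conjI ballI exI[of _ "\<phi> ` S"]) auto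
qed

theorem corollary4p9:
  shows "locally_connected_space (unitary_topology :: 'a::unital_cstar_algebra topology) \<and>
    (topological_group.bounded_group (unitary_group :: 'a monoid) unitary_topology \<longleftrightarrow>
      finite (connected_components_of (unitary_topology :: 'a topology)) \<and>
      topological_group.bounded_group (unitary_group_0 :: 'a monoid) unitary_topology_0)"
proof -
  have one: "\<one>\<^bsub>unitary_group\<^esub> = (1 :: 'a)"
    by (simp add: unitary_group_def)
  have lc: "locally_connected_space (unitary_topology :: 'a topology)"
    using unitary.locally_connected_space_if_at_one[where ?'a = 'a]
      weakly_locally_connected_at_one_unitary one by simp
  have "(unitary_identity_component :: 'a set) \<subseteq> unitary_elements"
    using connected_component_of_subset_topspace[of unitary_topology "1 :: 'a"]
    by (simp add: unitary_topology_def)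
  then have top0: "unitary_topology_0 = subtopology unitary_topology (unitary_identity_component :: 'a set)"
    by (simp add: unitary_topology_0_def unitary_topology_def subtopology_subtopology inf.absorb2)
  have "openin unitary_topology (unitary_identity_component :: 'a set)"
    using lc by (rule openin_connected_component_of_locally_connected_space)
  then show ?thesis
    using unitary.bounded_group_iff_open_subgroup[OF unitary.subgroup_identity_component, where ?'a = 'a]
      unitary.connected_components_eq_rcosets[where ?'a = 'a] lc
    by (simp add: one top0 unitary_group_0_def)
qed

end
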